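(* Let $m\ge 1$ be a fixed integer and let $S\subseteq\mathbb{R}^m$ be semialgebraic. (a) Over the class of all laws of i.i.d. sequences $Y_1,Y_2,\ldots$ of random vectors in $\mathbb{R}^m$ whose observations are supported on $[0,1]^m$, membership of the mean $\theta=\mathbb{E}Y_1$ in $S$ is eventually almost surely predictable. (b) Fix a real number $r>1$. Over the class of all laws of i.i.d. sequences $Y_1,Y_2,\ldots$ of random vectors in $\mathbb{R}^m$ satisfying $\mathbb{E}\|Y_1\|_2^r<\infty$, membership of $\theta=\mathbb{E}Y_1$ in $S$ is eventually almost surely predictable.
   Context: A subset of $\mathbb{R}^m$ is semialgebraic if it can be obtained from finitely many sets defined by polynomial equalities and inequalities (real coefficients) by finitely many unions, intersections, and complements. Let $Y_1,Y_2,\ldots$ be i.i.d. random vectors in $\mathbb{R}^m$ with mean $\theta=\mathbb{E}Y_1$. A predictor is a sequence $(\Phi_N)_{N\ge1}$ of Borel maps $\Phi_N:(\mathbb{R}^m)^N\to\{0,1\}$. For $S\subseteq\mathbb{R}^m$ and a class $\mathcal{P}$ of laws, membership of $\theta$ in $S$ is eventually almost surely predictable over $\mathcal{P}$ if there is a single predictor $(\Phi_N)$ (not depending on the law) such that for every $P\in\mathcal{P}$, $$P\left(\Phi_N(Y_1,\ldots,Y_N)=\mathbf{1}\{\theta\in S\}\text{ for all sufficiently large }N\right)=1,$$ where $\theta$ is the mean under $P$. Here $\|\cdot\|_2$ is the Euclidean norm. *)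

theory Defs
  imports "HOL-Probability.Probability"
begin

text \<open>
  \<open>real_polynomial_function\<close> is the closure of the linear functionals and the constants under
  sums and products, so on \<open>real ^ 'm\<close> it describes exactly the polynomial functions
  in the \<open>m\<close> coordinates.
\<close>

inductive semialgebraic :: "'a::euclidean_space set \<Rightarrow> bool" where
  poly_eq: "real_polynomial_function p \<Longrightarrow> semialgebraic {x. p x = 0}"
| poly_less: "real_polynomial_function p \<Longrightarrow> semialgebraic {x. p x < 0}"
| union: "semialgebraic A \<Longrightarrow> semialgebraic B \<Longrightarrow> semialgebraic (A \<union> B)"
| inter: "semialgebraic A \<Longrightarrow> semialgebraic B \<Longrightarrow> semialgebraic (A \<inter> B)"
| compl: "semialgebraic A \<Longrightarrow> semialgebraic (- A)"

text \<open>
  A sequence is represented by its law on the path space \<open>nat \<Rightarrow> 'a\<close>, on which the observations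
  are the coordinate maps. Indices start at \<open>0\<close>, so \<open>\<omega> i\<close> is the observation \<open>Y\<close> number \<open>i + 1\<close>.
\<close>

definition iid_laws :: "(nat \<Rightarrow> 'a::euclidean_space) measure set" where
  "iid_laws = {P. prob_space P \<and> sets P = sets (PiM UNIV (\<lambda>_. borel)) \<and>
     prob_space.indep_vars P (\<lambda>_. borel) (\<lambda>i \<omega>. \<omega> i) UNIV \<and>
     (\<forall>i. distr P borel (\<lambda>\<omega>. \<omega> i) = distr P borel (\<lambda>\<omega>. \<omega> 0))}"

definition mean :: "(nat \<Rightarrow> 'a::euclidean_space) measure \<Rightarrow> 'a" where
  "mean P = (\<integral>\<omega>. \<omega> 0 \<partial>P)"

text \<open>
  An element of the \<open>N\<close>-fold power of \<open>'a\<close> is a function on \<open>{..<N}\<close>, extended by \<open>undefined\<close>.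
  As \<open>'a\<close> is second countable, the product sigma-algebra is the Borel sigma-algebra of that power.
\<close>

definition predictor :: "(nat \<Rightarrow> (nat \<Rightarrow> 'a::euclidean_space) \<Rightarrow> nat) \<Rightarrow> bool" where
  "predictor \<Phi> \<longleftrightarrow> (\<forall>N\<ge>1. \<Phi> N \<in> PiM {..<N} (\<lambda>_. borel) \<rightarrow>\<^sub>M count_space {0, 1})"

definition eventually_as_predictable ::
    "'a::euclidean_space set \<Rightarrow> (nat \<Rightarrow> 'a) measure set \<Rightarrow> bool" where
  "eventually_as_predictable S \<P> \<longleftrightarrow>
     (\<exists>\<Phi>. predictor \<Phi> \<and>
       (\<forall>P\<in>\<P>. measure P {\<omega> \<in> space P.
          \<forall>\<^sub>F N in sequentially. \<Phi> N (restrict \<omega> {..<N}) = indicator S (mean P)} = 1))"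

end

theory Submission
  imports Defs "HOL-Library.Discrete_Functions"
begin

text \<open>
  The mean can be estimated with a known rate: for every moment exponent \<open>r > 1\<close> there are
  estimators \<open>T N\<close> of the mean and deterministic radii \<open>\<epsilon> N \<longlonglongrightarrow> 0\<close>, the same for all laws with a
  finite \<open>r\<close>-th moment, such that almost surely \<open>T N\<close> is eventually within \<open>\<epsilon> N\<close> of the mean
  (\<open>dyadic_estimator_rate\<close>). The law may influence when this starts to hold, but not \<open>\<epsilon>\<close>.

  Such a rate decides the sign of a polynomial \<open>p\<close> at the mean \<open>\<theta>\<close>, even on the boundary
  \<open>p \<theta> = 0\<close>: predict \<open>p \<theta> < 0\<close> iff \<open>p (T N) < - sqrt (\<epsilon> N)\<close>. If \<open>p \<theta> < 0\<close>, the left-hand side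
  has a negative limit while the right-hand side tends to zero. If \<open>p \<theta> \<ge> 0\<close>, then \<open>p\<close> is Lipschitz
  near \<open>\<theta>\<close> with some unknown constant \<open>L\<close>, so \<open>p (T N) \<ge> - L * \<epsilon> N\<close>, and \<open>L * \<epsilon> N\<close> is eventually
  smaller than \<open>sqrt (\<epsilon> N)\<close>, whatever \<open>L\<close> is. Predictable sets are closed under Boolean
  operations because predictors can be combined pointwise, and the sets \<open>{x. p x < 0}\<close> generate all
  semialgebraic sets (\<open>eventually_as_predictable_semialgebraic\<close>).

  The estimator is free to be convenient. At time \<open>N\<close> it uses only the first \<open>k = 2 ^ n\<close>
  observations, where \<open>2 ^ n \<le> N < 2 ^ Suc n\<close>, and averages in each coordinate the values of modulus
  at most \<open>k\<close>, replacing the others by zero. Truncation gives variance and bias of order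
  \<open>k powr (1 - r)\<close> (for \<open>r \<le> 2\<close>, which is no loss of generality), so Chebyshev's inequality yields
  error probabilities that decay geometrically in \<open>n\<close>, and the Borel--Cantelli lemma applies.
  Observations in the unit cube have finite second moments, so the bounded case is an instance
  of the moment case.
\<close>

section \<open>Variance of sums of independent variables\<close>

lemma (in prob_space) variance_sum_indep_vars:
  fixes W :: "'i \<Rightarrow> 'a \<Rightarrow> real"
  assumes indep: "indep_vars (\<lambda>_. borel) W I" and "finite I"
    and sq: "\<And>i. i \<in> I \<Longrightarrow> integrable M (\<lambda>\<omega>. (W i \<omega>)\<^sup>2)"
  shows "variance (\<lambda>\<omega>. \<Sum>i\<in>I. W i \<omega>) = (\<Sum>i\<in>I. variance (W i))"
proof -
  have meas [measurable]: "random_variable borel (W i)" if "i \<in> I" for i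
    using indep that by (auto simp: indep_vars_def)
  have int: "integrable M (W i)" if "i \<in> I" for i
    using square_integrable_imp_integrable[OF meas sq] that by blast
  define Z where "Z i \<omega> = W i \<omega> - expectation (W i)" for i \<omega>
  have intZ: "integrable M (Z i)" and meanZ: "expectation (Z i) = 0" if "i \<in> I" for i
    using int[OF that] by (auto simp: Z_def[abs_def] prob_space)
  have prodZ: "integrable M (\<lambda>\<omega>. Z i \<omega> * Z j \<omega>) \<and>
      expectation (\<lambda>\<omega>. Z i \<omega> * Z j \<omega>) = (if i = j then variance (W i) else 0)"
    if ij: "i \<in> I" "j \<in> I" for i j
  proof (cases "i = j")
    case True
    have "integrable M (\<lambda>\<omega>. (W i \<omega> - expectation (W i))\<^sup>2)"
      unfolding power2_diff using int sq ij by auto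
    then show ?thesis using True by (simp add: Z_def power2_eq_square)
  next
    case False
    \<comment> \<open>A single variable is a sum over a singleton, and \<open>W i\<close> is independent of such sums.\<close>
    have "indep_var borel (W i) borel (W j)"
      using indep_vars_sum[of "{j}" i W] indep_vars_subset[OF indep, of "{i, j}"] ij False
      by simp
    then have "indep_var borel (Z i) borel (Z j)"
      using indep_var_compose[of borel "W i" borel "W j" "\<lambda>x. x - expectation (W i)" borel
          "\<lambda>x. x - expectation (W j)" borel]
      by (simp add: Z_def[abs_def] comp_def)
    then show ?thesis
      using indep_var_integrable[of "Z i" "Z j"] indep_var_lebesgue_integral[of "Z i" "Z j"]
        intZ meanZ ij False by simp
  qed
  have "variance (\<lambda>\<omega>. \<Sum>i\<in>I. W i \<omega>) = expectation (\<lambda>\<omega>. (\<Sum>i\<in>I. Z i \<omega>)\<^sup>2)"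
    using int by (simp add: Z_def sum_subtractf)
  also have "\<dots> = expectation (\<lambda>\<omega>. \<Sum>i\<in>I. \<Sum>j\<in>I. Z i \<omega> * Z j \<omega>)"
    by (simp add: power2_eq_square sum_product)
  also have "\<dots> = (\<Sum>i\<in>I. \<Sum>j\<in>I. expectation (\<lambda>\<omega>. Z i \<omega> * Z j \<omega>))"
    using prodZ by (simp add: Bochner_Integration.integral_sum)
  also have "\<dots> = (\<Sum>i\<in>I. \<Sum>j\<in>I. if i = j then variance (W i) else 0)"
    using prodZ by (intro sum.cong refl) simp
  also have "\<dots> = (\<Sum>i\<in>I. variance (W i))"
    using \<open>finite I\<close> by simp
  finally show ?thesis .
qed

section \<open>Truncated means of real random variables\<close>

definition truncate :: "real \<Rightarrow> real \<Rightarrow> real" where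
  "truncate k x = (if \<bar>x\<bar> \<le> k then x else 0)"

definition truncated_mean :: "nat \<Rightarrow> (nat \<Rightarrow> real) \<Rightarrow> real" where
  "truncated_mean k x = (\<Sum>i<k. truncate (real k) (x i)) / real k"

lemma truncate_measurable [measurable]: "truncate k \<in> borel_measurable borel"
  unfolding truncate_def[abs_def] by measurable

lemma truncate_square_le:
  assumes "0 < k" "1 < r" "r \<le> 2"
  shows "(truncate k x)\<^sup>2 \<le> k powr (2 - r) * \<bar>x\<bar> powr r"
proof (cases "\<bar>x\<bar> \<le> k \<and> x \<noteq> 0")
  case True
  have "x\<^sup>2 = \<bar>x\<bar> powr (2 - r) * \<bar>x\<bar> powr r"
    using True by (simp flip: powr_add)
  also have "\<dots> \<le> k powr (2 - r) * \<bar>x\<bar> powr r"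
    using True assms by (intro mult_right_mono powr_mono2) auto
  finally show ?thesis using True by (simp add: truncate_def)
qed (auto simp: truncate_def)

lemma truncate_error_le:
  assumes "0 < k" "1 < r"
  shows "\<bar>x - truncate k x\<bar> \<le> k powr (1 - r) * \<bar>x\<bar> powr r"
proof (cases "\<bar>x\<bar> \<le> k")
  case False
  then have "\<bar>x\<bar> = \<bar>x\<bar> powr (1 - r) * \<bar>x\<bar> powr r"
    using assms by (simp flip: powr_add)
  also have "\<dots> \<le> k powr (1 - r) * \<bar>x\<bar> powr r"
    using False assms by (intro mult_right_mono powr_mono2') auto
  finally show ?thesis using False by (simp add: truncate_def)
qed (auto simp: truncate_def)

lemma (in prob_space) integrable_norm_powr_mono:
  fixes X :: "'a \<Rightarrow> 'b::{banach, second_countable_topology}"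
  assumes [measurable]: "random_variable borel X" and "integrable M (\<lambda>\<omega>. norm (X \<omega>) powr r)" and s: "0 \<le> s" "s \<le> r"
  shows "integrable M (\<lambda>\<omega>. norm (X \<omega>) powr s)"
proof (rule Bochner_Integration.integrable_bound)
  show "integrable M (\<lambda>\<omega>. 1 + norm (X \<omega>) powr r)" using assms by simp
  have "y powr s \<le> 1 + y powr r" if "0 \<le> y" for y :: real
  proof (cases "y \<le> 1")
    case True
    then have "y powr s \<le> 1" using that s by (intro powr_le1) auto
    then show ?thesis by (smt (verit) powr_ge_zero)
  next
    case False
    then show ?thesis using powr_mono[of s r y] s by (simp add: add_increasing)
  qed
  then show "AE \<omega> in M. norm (norm (X \<omega>) powr s) \<le> norm (1 + norm (X \<omega>) powr r)"
    by (auto simp add: abs_of_nonneg)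
qed simp

text \<open>
  Both the bias of the truncated mean and its variance are at most \<open>m * k powr (1 - r)\<close>: the bias
  by \<open>truncate_error_le\<close>, and the variance because \<open>truncate_square_le\<close> bounds each of the \<open>k\<close>
  summands by \<open>m * k powr (2 - r)\<close>. The bias is added to the deviation \<open>a\<close>; Chebyshev's inequality
  handles the rest.
\<close>

lemma (in prob_space) truncated_mean_deviation:
  fixes X :: "nat \<Rightarrow> 'a \<Rightarrow> real" and r :: real and k :: nat
  defines "m \<equiv> expectation (\<lambda>\<omega>. \<bar>X 0 \<omega>\<bar> powr r)"
  assumes indep: "indep_vars (\<lambda>_. borel) X UNIV"
    and ident: "\<And>i. distr M borel (X i) = distr M borel (X 0)"
    and r: "1 < r" "r \<le> 2"
    and mom: "integrable M (\<lambda>\<omega>. \<bar>X 0 \<omega>\<bar> powr r)"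
    and "0 < k" "0 < a"
  shows "prob {\<omega> \<in> space M. a + m * k powr (1 - r) \<le>
             \<bar>truncated_mean k (\<lambda>i. X i \<omega>) - expectation (X 0)\<bar>} \<le> m * k powr (1 - r) / a\<^sup>2"
proof -
  have [measurable]: "random_variable borel (X i)" for i
    using indep by (auto simp: indep_vars_def)
  define W where "W i \<omega> = truncate k (X i \<omega>)" for i \<omega>
  define Tm where "Tm \<omega> = truncated_mean k (\<lambda>i. X i \<omega>)" for \<omega>
  have [measurable]: "random_variable borel (W i)" for i
    unfolding W_def[abs_def] by measurable
  have Tm_eq: "Tm = (\<lambda>\<omega>. (\<Sum>i<k. W i \<omega>) / k)"
    by (simp add: Tm_def[abs_def] truncated_mean_def W_def)
  have [measurable]: "random_variable borel Tm"
    unfolding Tm_eq by measurable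
  have same: "expectation (\<lambda>\<omega>. f (X i \<omega>)) = expectation (\<lambda>\<omega>. f (X 0 \<omega>))"
    if [measurable]: "f \<in> borel_measurable borel" for f :: "real \<Rightarrow> real" and i
    using integral_distr[of "X i" M borel f] integral_distr[of "X 0" M borel f] ident[of i] by simp
  have W_le: "\<bar>W i \<omega>\<bar> \<le> k" for i \<omega>
    by (simp add: W_def truncate_def)
  have intW: "integrable M (W i)" and intW2: "integrable M (\<lambda>\<omega>. (W i \<omega>)\<^sup>2)" for i
  proof -
    show "integrable M (W i)"
      using W_le by (intro integrable_const_bound[where B = k]) auto
    show "integrable M (\<lambda>\<omega>. (W i \<omega>)\<^sup>2)"
      using W_le power_mono[OF W_le, of _ _ 2]
      by (intro integrable_const_bound[where B = "(real k)\<^sup>2"]) auto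
  qed
  have EW: "expectation (W i) = expectation (W 0)" for i
    unfolding W_def[abs_def] by (rule same) measurable
  have VW: "variance (W i) \<le> k powr (2 - r) * m" for i
  proof -
    have "variance (W i) \<le> expectation (\<lambda>\<omega>. (W i \<omega>)\<^sup>2)"
      using variance_eq[OF intW intW2] by simp
    also have "\<dots> = expectation (\<lambda>\<omega>. (W 0 \<omega>)\<^sup>2)"
      unfolding W_def[abs_def] by (rule same) measurable
    also have "\<dots> \<le> expectation (\<lambda>\<omega>. k powr (2 - r) * \<bar>X 0 \<omega>\<bar> powr r)"
      using intW2 mom \<open>0 < k\<close> r
      by (intro integral_mono) (auto simp: W_def intro!: truncate_square_le)
    finally show ?thesis by (simp add: m_def)
  qed
  have indepW: "indep_vars (\<lambda>_. borel) W {..<k}"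
    unfolding W_def[abs_def]
    by (rule indep_vars_compose2[OF indep_vars_subset[OF indep]]) auto
  have ETm: "expectation Tm = expectation (W 0)"
  proof -
    have "expectation Tm = (\<Sum>i<k. expectation (W i)) / k"
      using intW by (simp add: Tm_eq)
    also have "\<dots> = (\<Sum>i<k. expectation (W 0)) / k"
      by (intro arg_cong2[where f = divide] sum.cong refl EW)
    finally
    show ?thesis using \<open>0 < k\<close> by simp
  qed
  have "variance Tm = variance (\<lambda>\<omega>. \<Sum>i<k. W i \<omega>) / k\<^sup>2"
    by (simp add: Tm_eq power_divide flip: diff_divide_distrib)
  also have "\<dots> = (\<Sum>i<k. variance (W i)) / k\<^sup>2"
    using variance_sum_indep_vars[OF indepW] intW2 by simp
  also have "\<dots> \<le> (\<Sum>i<k. k powr (2 - r) * m) / k\<^sup>2"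
    by (intro divide_right_mono sum_mono VW) auto
  also have "\<dots> = m * k powr (1 - r)"
    using \<open>0 < k\<close> by (simp add: powr_diff power2_eq_square)
  finally have VTm: "variance Tm \<le> m * k powr (1 - r)" .
  have sqTm: "integrable M (\<lambda>\<omega>. (Tm \<omega>)\<^sup>2)"
  proof (rule integrable_const_bound[where B = "(real k)\<^sup>2"])
    have "\<bar>Tm \<omega>\<bar> \<le> k" for \<omega>
    proof -
      have "\<bar>\<Sum>i<k. W i \<omega>\<bar> \<le> (\<Sum>i<k. real k)"
        by (rule order_trans[OF sum_abs sum_mono[OF W_le]])
      then show ?thesis using \<open>0 < k\<close> by (simp add: Tm_eq field_simps)
    qed
    then show "AE \<omega> in M. norm ((Tm \<omega>)\<^sup>2) \<le> (real k)\<^sup>2"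
      using power_mono[of "\<bar>Tm _\<bar>" k 2] by auto
  qed measurable
  have intX: "integrable M (X 0)"
    using integrable_norm_powr_mono[of "X 0" r 1] mom r by (simp add: integrable_abs_iff)
  have "\<bar>expectation (X 0) - expectation Tm\<bar> = \<bar>expectation (\<lambda>\<omega>. X 0 \<omega> - W 0 \<omega>)\<bar>"
    using intX intW ETm by simp
  also have "\<dots> \<le> expectation (\<lambda>\<omega>. \<bar>X 0 \<omega> - W 0 \<omega>\<bar>)"
    by (rule integral_abs_bound)
  also have "\<dots> \<le> expectation (\<lambda>\<omega>. k powr (1 - r) * \<bar>X 0 \<omega>\<bar> powr r)"
  proof (rule integral_mono)
    show "integrable M (\<lambda>\<omega>. \<bar>X 0 \<omega> - W 0 \<omega>\<bar>)"
      using intX intW by simp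
    show "\<bar>X 0 \<omega> - W 0 \<omega>\<bar> \<le> k powr (1 - r) * \<bar>X 0 \<omega>\<bar> powr r" for \<omega>
      unfolding W_def using \<open>0 < k\<close> r by (intro truncate_error_le) auto
  qed (use mom in simp)
  finally have bias: "\<bar>expectation (X 0) - expectation Tm\<bar> \<le> m * k powr (1 - r)"
    by (simp add: m_def mult.commute)
  have "prob {\<omega> \<in> space M. a + m * k powr (1 - r) \<le> \<bar>Tm \<omega> - expectation (X 0)\<bar>}
      \<le> prob {\<omega> \<in> space M. a \<le> \<bar>Tm \<omega> - expectation Tm\<bar>}"
    using bias by (intro finite_measure_mono) auto
  also have "\<dots> \<le> variance Tm / a\<^sup>2"
    using Chebyshev_inequality[of Tm a] sqTm \<open>0 < a\<close> by simp
  also have "\<dots> \<le> m * k powr (1 - r) / a\<^sup>2"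
    using VTm by (intro divide_right_mono) auto
  finally show ?thesis by (simp add: Tm_def)
qed


text \<open>
  With \<open>k = 2 ^ n\<close>, the bound \<open>m * k powr (1 - r)\<close> on bias and variance equals \<open>m * q ^ (4 * n)\<close>.
  For the deviation \<open>a = q ^ n\<close> the error probability is therefore at most \<open>m * q ^ (2 * n)\<close>, which
  is summable, while the bias is eventually below \<open>q ^ n\<close>. The moment \<open>m\<close> only delays the start of
  the estimate: the radius \<open>2 * q ^ n\<close> depends on nothing but \<open>r\<close>.
\<close>

lemma (in prob_space) truncated_mean_rate:
  fixes X :: "nat \<Rightarrow> 'a \<Rightarrow> real" and r :: real
  defines "q \<equiv> 2 powr ((1 - r) / 4)"
  assumes indep: "indep_vars (\<lambda>_. borel) X UNIV"
    and ident: "\<And>i. distr M borel (X i) = distr M borel (X 0)"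
    and r: "1 < r" "r \<le> 2"
    and mom: "integrable M (\<lambda>\<omega>. \<bar>X 0 \<omega>\<bar> powr r)"
  shows "AE \<omega> in M. \<forall>\<^sub>F n in sequentially.
           \<bar>truncated_mean (2 ^ n) (\<lambda>i. X i \<omega>) - expectation (X 0)\<bar> \<le> 2 * q ^ n"
proof -
  have [measurable]: "random_variable borel (X i)" for i
    using indep by (auto simp: indep_vars_def)
  define m where "m = expectation (\<lambda>\<omega>. \<bar>X 0 \<omega>\<bar> powr r)"
  define A where "A n = {\<omega> \<in> space M. q ^ n + m * real (2 ^ n) powr (1 - r) \<le>
      \<bar>truncated_mean (2 ^ n) (\<lambda>i. X i \<omega>) - expectation (X 0)\<bar>}" for n
  have q: "0 < q" "q < 1"
    using r powr_less_mono[of "(1 - r) / 4" 0 2] by (auto simp: q_def)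
  have pow: "real (2 ^ n) powr (1 - r) = q ^ (4 * n)" for n
  proof -
    have "real (2 ^ n) powr (1 - r) = 2 powr (real n * (1 - r))"
      by (simp add: powr_powr flip: powr_realpow)
    also have "\<dots> = q ^ (4 * n)"
      unfolding q_def by (subst powr_realpow[symmetric]) (simp_all add: powr_powr mult.commute)
    finally show ?thesis .
  qed
  have A_meas: "A n \<in> sets M" for n
    unfolding A_def truncated_mean_def by measurable
  have prob_A: "prob (A n) \<le> m * (q\<^sup>2) ^ n" for n
  proof -
    have "prob (A n) \<le> m * real (2 ^ n) powr (1 - r) / (q ^ n)\<^sup>2"
      using truncated_mean_deviation[OF indep ident r mom, of "2 ^ n" "q ^ n"] q
      by (simp add: A_def m_def)
    also have "q ^ (4 * n) = (q ^ n)\<^sup>2 * (q\<^sup>2) ^ n"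
      by (simp flip: power_mult power_add)
    then have "m * real (2 ^ n) powr (1 - r) / (q ^ n)\<^sup>2 = m * (q\<^sup>2) ^ n"
      unfolding pow using q by simp
    finally show ?thesis .
  qed
  have "summable (\<lambda>n. m * (q\<^sup>2) ^ n)"
    using q by (intro summable_mult summable_geometric) (simp add: power_less_one_iff)
  then have "summable (\<lambda>n. prob (A n))"
    by (rule summable_comparison_test'[where N = 0]) (use prob_A in simp)
  then have "AE \<omega> in M. \<forall>\<^sub>F n in sequentially. \<omega> \<in> space M - A n"
    using A_meas by (intro borel_cantelli_AE1) (auto simp: emeasure_eq_measure)
  moreover have "\<forall>\<^sub>F n in sequentially. m * real (2 ^ n) powr (1 - r) \<le> q ^ n"
  proof -
    have "(\<lambda>n. m * (q ^ 3) ^ n) \<longlonglongrightarrow> m * 0"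
      using q by (intro tendsto_mult tendsto_const LIMSEQ_realpow_zero)
        (auto simp: power_less_one_iff)
    then have "\<forall>\<^sub>F n in sequentially. m * (q ^ 3) ^ n < 1"
      by (intro order_tendstoD) auto
    then show ?thesis
    proof eventually_elim
      case (elim n)
      have "q ^ (4 * n) = q ^ n * (q ^ 3) ^ n"
        by (simp flip: power_mult power_add)
      then show ?case
        unfolding pow using elim q by simp
    qed
  qed
  ultimately show ?thesis
    by (elim AE_mp, intro AE_I2 impI) (auto simp: A_def elim: eventually_elim2)
qed

section \<open>Boolean operations on predictable sets\<close>

text \<open>
  A predictor need not be measurable at \<open>N = 0\<close>, so that index is dropped before the event is
  written with measurable maps.
\<close>

lemma sets_eventually_prediction:
  fixes M :: "(nat \<Rightarrow> 'a::euclidean_space) measure"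
  assumes sets: "sets M = sets (PiM UNIV (\<lambda>_. borel))" and \<Phi>: "predictor \<Phi>"
  shows "{\<omega> \<in> space M. \<forall>\<^sub>F N in sequentially. \<Phi> N (restrict \<omega> {..<N}) = c} \<in> sets M"
proof -
  have eq: "{\<omega> \<in> space M. \<forall>\<^sub>F N in sequentially. \<Phi> N (restrict \<omega> {..<N}) = c} =
      {\<omega> \<in> space M. \<forall>\<^sub>F N in sequentially. \<Phi> (Suc N) (restrict \<omega> {..<Suc N}) = c}"
    by (subst eventually_sequentially_Suc) (rule refl)
  have "(\<lambda>\<omega>. restrict \<omega> {..<N}) \<in> M \<rightarrow>\<^sub>M PiM {..<N} (\<lambda>_. borel)" for N
    unfolding measurable_cong_sets[OF sets refl] by (rule measurable_restrict_subset) simp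
  moreover have "\<Phi> (Suc N) \<in> PiM {..<Suc N} (\<lambda>_. borel) \<rightarrow>\<^sub>M count_space {0, 1}" for N
    using \<Phi> by (auto simp: predictor_def)
  ultimately have "(\<lambda>\<omega>. \<Phi> (Suc N) (restrict \<omega> {..<Suc N})) \<in> M \<rightarrow>\<^sub>M count_space {0, 1}" for N
    by (rule measurable_compose)
  then have [measurable]:
      "(\<lambda>\<omega>. \<Phi> (Suc N) (restrict \<omega> {..<Suc N})) \<in> M \<rightarrow>\<^sub>M count_space UNIV" for N
    by (rule measurable_compose) simp
  show ?thesis
    unfolding eq by measurable
qed

text \<open>
  The probability in the definition of predictability is taken of a measurable event, so it can be
  traded for an almost-everywhere statement; those compose more easily.
\<close>

lemma eventually_as_predictable_iff_AE:
  assumes "\<P> \<subseteq> iid_laws"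
  shows "eventually_as_predictable S \<P> \<longleftrightarrow>
    (\<exists>\<Phi>. predictor \<Phi> \<and> (\<forall>P\<in>\<P>. AE \<omega> in P. \<forall>\<^sub>F N in sequentially.
        \<Phi> N (restrict \<omega> {..<N}) = indicator S (mean P)))"
proof -
  have "measure P {\<omega> \<in> space P. \<forall>\<^sub>F N in sequentially. \<Phi> N (restrict \<omega> {..<N}) = indicator S (mean P)} = 1
      \<longleftrightarrow> (AE \<omega> in P. \<forall>\<^sub>F N in sequentially. \<Phi> N (restrict \<omega> {..<N}) = indicator S (mean P))"
    if "P \<in> \<P>" "predictor \<Phi>" for P and \<Phi> :: "nat \<Rightarrow> (nat \<Rightarrow> 'a) \<Rightarrow> nat"
  proof -
    have P: "prob_space P" "sets P = sets (PiM UNIV (\<lambda>_. borel))"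
      using that assms by (auto simp: iid_laws_def)
    show ?thesis
      by (rule prob_space.prob_Collect_eq_1[OF P(1)
            sets_eventually_prediction[OF P(2) that(2)]])
  qed
  then show ?thesis
    unfolding eventually_as_predictable_def by blast
qed

lemma eventually_as_predictable_mono:
  assumes "eventually_as_predictable S \<Q>" "\<P> \<subseteq> \<Q>"
  shows "eventually_as_predictable S \<P>"
  using assms unfolding eventually_as_predictable_def by blast

lemma eventually_as_predictable_Compl:
  assumes iid: "\<P> \<subseteq> iid_laws" and "eventually_as_predictable S \<P>"
  shows "eventually_as_predictable (- S) \<P>"
proof -
  obtain \<Phi> where \<Phi>: "predictor \<Phi>" and conv: "\<And>P. P \<in> \<P> \<Longrightarrow> AE \<omega> in P. \<forall>\<^sub>F N in sequentially.
      \<Phi> N (restrict \<omega> {..<N}) = indicator S (mean P)"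
    using assms eventually_as_predictable_iff_AE[OF iid] by blast
  define \<Psi> where "\<Psi> N y = 1 - \<Phi> N y" for N y
  have "predictor \<Psi>"
    unfolding predictor_def
  proof (intro allI impI)
    fix N :: nat assume "1 \<le> N"
    then have "\<Phi> N \<in> PiM {..<N} (\<lambda>_. borel) \<rightarrow>\<^sub>M count_space {0, 1}"
      using \<Phi> by (simp add: predictor_def)
    then show "\<Psi> N \<in> PiM {..<N} (\<lambda>_. borel) \<rightarrow>\<^sub>M count_space {0, 1}"
      unfolding \<Psi>_def[abs_def] by (rule measurable_compose) auto
  qed
  moreover have "AE \<omega> in P. \<forall>\<^sub>F N in sequentially.
      \<Psi> N (restrict \<omega> {..<N}) = indicator (- S) (mean P)" if "P \<in> \<P>" for P
    using conv[OF that]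
    by eventually_elim (auto simp: \<Psi>_def indicator_def elim!: eventually_mono)
  ultimately show ?thesis
    using eventually_as_predictable_iff_AE[OF iid] by blast
qed

lemma eventually_as_predictable_Un:
  assumes iid: "\<P> \<subseteq> iid_laws"
    and "eventually_as_predictable S \<P>" "eventually_as_predictable T \<P>"
  shows "eventually_as_predictable (S \<union> T) \<P>"
proof -
  obtain \<Phi> where \<Phi>: "predictor \<Phi>" and conv\<Phi>: "\<And>P. P \<in> \<P> \<Longrightarrow> AE \<omega> in P. \<forall>\<^sub>F N in sequentially.
      \<Phi> N (restrict \<omega> {..<N}) = indicator S (mean P)"
    using assms eventually_as_predictable_iff_AE[OF iid] by blast
  obtain \<Psi> where \<Psi>: "predictor \<Psi>" and conv\<Psi>: "\<And>P. P \<in> \<P> \<Longrightarrow> AE \<omega> in P. \<forall>\<^sub>F N in sequentially.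
      \<Psi> N (restrict \<omega> {..<N}) = indicator T (mean P)"
    using assms eventually_as_predictable_iff_AE[OF iid] by blast
  define \<Xi> where "\<Xi> N y = max (\<Phi> N y) (\<Psi> N y)" for N y
  have "predictor \<Xi>"
    unfolding predictor_def
  proof (intro allI impI)
    fix N :: nat assume "1 \<le> N"
    then have "\<Phi> N \<in> PiM {..<N} (\<lambda>_. borel) \<rightarrow>\<^sub>M count_space {0, 1}"
      "\<Psi> N \<in> PiM {..<N} (\<lambda>_. borel) \<rightarrow>\<^sub>M count_space {0, 1}"
      using \<Phi> \<Psi> by (simp_all add: predictor_def)
    then have "(\<lambda>y. (\<Phi> N y, \<Psi> N y))
        \<in> PiM {..<N} (\<lambda>_. borel) \<rightarrow>\<^sub>M count_space {0, 1} \<Otimes>\<^sub>M count_space {0, 1}"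
      by (rule measurable_Pair)
    then have "(\<lambda>y. (\<Phi> N y, \<Psi> N y)) \<in> PiM {..<N} (\<lambda>_. borel) \<rightarrow>\<^sub>M count_space ({0, 1} \<times> {0, 1})"
      by (subst (asm) pair_measure_countable) (auto intro: countable_finite)
    then have "(\<lambda>y. case (\<Phi> N y, \<Psi> N y) of (a, b) \<Rightarrow> max a b)
        \<in> PiM {..<N} (\<lambda>_. borel) \<rightarrow>\<^sub>M count_space {0, 1}"
      by (rule measurable_compose) auto
    then show "\<Xi> N \<in> PiM {..<N} (\<lambda>_. borel) \<rightarrow>\<^sub>M count_space {0, 1}"
      unfolding \<Xi>_def[abs_def] by simp
  qed
  moreover have "AE \<omega> in P. \<forall>\<^sub>F N in sequentially.
      \<Xi> N (restrict \<omega> {..<N}) = indicator (S \<union> T) (mean P)" if "P \<in> \<P>" for P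
    using conv\<Phi>[OF that] conv\<Psi>[OF that]
  proof eventually_elim
    case (elim \<omega>)
    then show ?case
      by eventually_elim (auto simp: \<Xi>_def indicator_def)
  qed
  ultimately show ?thesis
    using eventually_as_predictable_iff_AE[OF iid] by blast
qed

section \<open>Deciding polynomial inequalities from an estimator with a rate\<close>

lemma real_polynomial_function_locally_Lipschitz:
  fixes p :: "'a::euclidean_space \<Rightarrow> real"
  assumes "real_polynomial_function p"
  obtains L where "0 < L" "\<forall>\<^sub>F x in nhds \<theta>. \<bar>p x - p \<theta>\<bar> \<le> L * norm (x - \<theta>)"
proof -
  obtain D where "(p has_derivative D) (at \<theta>)"
    using differentiable_at_real_polynomial_function[OF assms] unfolding differentiable_def by blast
  then obtain d where D: "bounded_linear D" and "0 < d"
    and d: "\<And>y. norm (y - \<theta>) < d \<Longrightarrow> norm (p y - p \<theta> - D (y - \<theta>)) \<le> 1 * norm (y - \<theta>)"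
    unfolding has_derivative_at_alt by (metis zero_less_one)
  have bound: "\<bar>p y - p \<theta>\<bar> \<le> (onorm D + 1) * norm (y - \<theta>)" if "dist y \<theta> < d" for y
    using d[of y] onorm[OF D, of "y - \<theta>"] that by (auto simp: dist_norm algebra_simps)
  show thesis
  proof
    show "0 < onorm D + 1"
      using onorm_pos_le[OF D] by simp
    show "\<forall>\<^sub>F x in nhds \<theta>. \<bar>p x - p \<theta>\<bar> \<le> (onorm D + 1) * norm (x - \<theta>)"
      unfolding eventually_nhds_metric using bound \<open>0 < d\<close> by blast
  qed
qed

text \<open>
  The threshold must tend to zero, so as not to miss a small negative \<open>p \<theta>\<close>, yet more slowly than
  every multiple \<open>L * \<epsilon> N\<close>, since the Lipschitz constant at \<open>\<theta>\<close> is unknown. The square root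
  achieves both.
\<close>

lemma eventually_less_threshold_iff:
  fixes p :: "'a::euclidean_space \<Rightarrow> real"
  assumes p: "real_polynomial_function p"
    and \<epsilon>: "\<epsilon> \<longlonglongrightarrow> 0" "\<And>N. 0 < \<epsilon> N"
    and x: "\<forall>\<^sub>F N in sequentially. norm (x N - \<theta>) \<le> \<epsilon> N"
  shows "\<forall>\<^sub>F N in sequentially. p (x N) < - sqrt (\<epsilon> N) \<longleftrightarrow> p \<theta> < 0"
proof -
  obtain L where L: "0 < L" and lip: "\<forall>\<^sub>F x in nhds \<theta>. \<bar>p x - p \<theta>\<bar> \<le> L * norm (x - \<theta>)"
    using real_polynomial_function_locally_Lipschitz[OF p] by blast
  have "(\<lambda>N. x N - \<theta>) \<longlonglongrightarrow> 0"
    using x \<epsilon>(1) by (rule Lim_null_comparison)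
  then have lim: "x \<longlonglongrightarrow> \<theta>"
    by (simp add: LIM_zero_iff)
  have sqrt_lim: "(\<lambda>N. sqrt (\<epsilon> N)) \<longlonglongrightarrow> 0"
    using tendsto_real_sqrt[OF \<epsilon>(1)] by simp
  show ?thesis
  proof (cases "p \<theta> < 0")
    case True
    have "(\<lambda>N. p (x N) + sqrt (\<epsilon> N)) \<longlonglongrightarrow> p \<theta> + 0"
      using isCont_tendsto_compose[OF continuous_real_polymonial_function[OF p] lim] sqrt_lim
      by (rule tendsto_add)
    then have "\<forall>\<^sub>F N in sequentially. p (x N) + sqrt (\<epsilon> N) < 0"
      using True by (intro order_tendstoD) auto
    then show ?thesis
      by eventually_elim (use True in auto)
  next
    case False
    have "\<forall>\<^sub>F N in sequentially. sqrt (\<epsilon> N) < 1 / L"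
      using sqrt_lim L by (intro order_tendstoD) auto
    moreover have "\<forall>\<^sub>F N in sequentially. \<bar>p (x N) - p \<theta>\<bar> \<le> L * norm (x N - \<theta>)"
      using lim lip by (auto simp: filterlim_iff)
    ultimately show ?thesis
      using x
    proof eventually_elim
      case (elim N)
      have "\<bar>p (x N) - p \<theta>\<bar> \<le> L * \<epsilon> N"
        using elim L by (smt (verit) mult_left_mono)
      also have "\<dots> = L * sqrt (\<epsilon> N) * sqrt (\<epsilon> N)"
        using \<epsilon>(2)[of N] by simp
      also have "\<dots> \<le> 1 * sqrt (\<epsilon> N)"
        using elim L \<epsilon>(2)[of N] by (intro mult_right_mono) (auto simp: field_simps)
      finally show ?case using False by auto
    qed
  qed
qed

lemma eventually_as_predictable_poly_less:
  fixes p :: "'a::euclidean_space \<Rightarrow> real"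
  assumes iid: "\<P> \<subseteq> iid_laws" and p: "real_polynomial_function p"
    and T: "\<And>N. T N \<in> PiM {..<N} (\<lambda>_. borel) \<rightarrow>\<^sub>M borel"
    and \<epsilon>: "\<epsilon> \<longlonglongrightarrow> 0" "\<And>N. 0 < \<epsilon> N"
    and rate: "\<And>P. P \<in> \<P> \<Longrightarrow> AE \<omega> in P. \<forall>\<^sub>F N in sequentially.
                 norm (T N (restrict \<omega> {..<N}) - mean P) \<le> \<epsilon> N"
  shows "eventually_as_predictable {x. p x < 0} \<P>"
proof -
  define \<Phi> :: "nat \<Rightarrow> (nat \<Rightarrow> 'a) \<Rightarrow> nat"
    where "\<Phi> N y = (if p (T N y) < - sqrt (\<epsilon> N) then 1 else 0)" for N y
  have [measurable]: "p \<in> borel_measurable borel"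
    using continuous_real_polymonial_function[OF p]
    by (intro borel_measurable_continuous_onI continuous_at_imp_continuous_on) auto
  note [measurable] = T
  have "predictor \<Phi>"
    unfolding predictor_def \<Phi>_def by (intro allI impI) measurable
  moreover have "AE \<omega> in P. \<forall>\<^sub>F N in sequentially.
      \<Phi> N (restrict \<omega> {..<N}) = indicator {x. p x < 0} (mean P)" if "P \<in> \<P>" for P
    using rate[OF that]
  proof eventually_elim
    case (elim \<omega>)
    from eventually_less_threshold_iff[OF p \<epsilon> elim] show ?case
      by eventually_elim (simp add: \<Phi>_def)
  qed
  ultimately show ?thesis
    using eventually_as_predictable_iff_AE[OF iid] by blast
qed

lemma eventually_as_predictable_semialgebraic:
  fixes S :: "'a::euclidean_space set"
  assumes S: "semialgebraic S" and iid: "\<P> \<subseteq> iid_laws"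
    and T: "\<And>N. T N \<in> PiM {..<N} (\<lambda>_. borel) \<rightarrow>\<^sub>M borel"
    and \<epsilon>: "\<epsilon> \<longlonglongrightarrow> 0" "\<And>N. 0 < \<epsilon> N"
    and rate: "\<And>P. P \<in> \<P> \<Longrightarrow> AE \<omega> in P. \<forall>\<^sub>F N in sequentially.
                 norm (T N (restrict \<omega> {..<N}) - mean P) \<le> \<epsilon> N"
  shows "eventually_as_predictable S \<P>"
  using S
proof induction
  case (poly_less p)
  then show ?case
    using eventually_as_predictable_poly_less[OF iid _ T \<epsilon> rate] by blast
next
  case (poly_eq p)
  note less = eventually_as_predictable_poly_less[OF iid _ T \<epsilon> rate]
  have "{x. p x = 0} = - ({x. p x < 0} \<union> {x. - p x < 0})"
    by auto
  moreover have "eventually_as_predictable (- ({x. p x < 0} \<union> {x. - p x < 0})) \<P>"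
    by (intro eventually_as_predictable_Compl[OF iid] eventually_as_predictable_Un[OF iid]
        less poly_eq real_polynomial_function_minus)
  ultimately show ?case by (simp only:)
next
  case (union A B)
  then show ?case by (simp add: eventually_as_predictable_Un[OF iid])
next
  case (inter A B)
  have "A \<inter> B = - (- A \<union> - B)" by auto
  moreover have "eventually_as_predictable (- (- A \<union> - B)) \<P>"
    by (intro eventually_as_predictable_Compl[OF iid] eventually_as_predictable_Un[OF iid] inter)
  ultimately show ?case by (simp only:)
next
  case (compl A)
  then show ?case by (simp add: eventually_as_predictable_Compl[OF iid])
qed

section \<open>An estimator of the mean with a uniform rate\<close>

text \<open>
  Being constant for \<open>2 ^ n \<le> N < 2 ^ Suc n\<close>, the estimator needs no interpolation between the
  dyadic times at which the Borel--Cantelli lemma is applied.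
\<close>

definition dyadic_estimator :: "nat \<Rightarrow> (nat \<Rightarrow> 'a::euclidean_space) \<Rightarrow> 'a" where
  "dyadic_estimator N y =
     (\<Sum>b\<in>Basis. truncated_mean (2 ^ floor_log N) (\<lambda>i. y i \<bullet> b) *\<^sub>R b)"

lemma filterlim_floor_log: "filterlim floor_log at_top sequentially"
  unfolding filterlim_at_top
proof
  fix n :: nat
  show "\<forall>\<^sub>F N in sequentially. n \<le> floor_log N"
    using eventually_ge_at_top[of "2 ^ n :: nat"]
    by eventually_elim (metis floor_log_le_iff floor_log_power)
qed

lemma dyadic_estimator_measurable:
  "dyadic_estimator N \<in> PiM {..<N} (\<lambda>_. borel :: 'a::euclidean_space measure) \<rightarrow>\<^sub>M borel"
proof (cases "N = 0")
  case True
  \<comment> \<open>The estimator then reads \<open>y 0\<close>, outside the index set; but the product space is one point.\<close>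
  then show ?thesis by (simp add: PiM_empty measurable_def sets_PiM_empty)
next
  case False
  have "i < N" if "i < 2 ^ floor_log N" for i
    using that floor_log_exp2_le[of N] False by simp
  then show ?thesis
    unfolding dyadic_estimator_def truncated_mean_def by (auto intro!: borel_measurable_sum)
qed

lemma dyadic_estimator_restrict:
  assumes "0 < N"
  shows "dyadic_estimator N (restrict y {..<N}) = dyadic_estimator N y"
proof -
  have "i < N" if "i < 2 ^ floor_log N" for i
    using that floor_log_exp2_le[OF assms] by simp
  then show ?thesis
    by (simp add: dyadic_estimator_def truncated_mean_def)
qed

lemma dyadic_estimator_rate:
  fixes P :: "(nat \<Rightarrow> 'a::euclidean_space) measure"
  assumes P: "P \<in> iid_laws" and r: "1 < r" "r \<le> 2"
    and mom: "integrable P (\<lambda>\<omega>. norm (\<omega> 0) powr r)"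
  shows "AE \<omega> in P. \<forall>\<^sub>F N in sequentially.
    norm (dyadic_estimator N (restrict \<omega> {..<N}) - mean P)
      \<le> real DIM('a) * (2 * (2 powr ((1 - r) / 4)) ^ floor_log N)"
proof -
  interpret prob_space P
    using P by (simp add: iid_laws_def)
  have indep: "indep_vars (\<lambda>_. borel) (\<lambda>i \<omega>. \<omega> i) UNIV"
    and ident: "\<And>i. distr P borel (\<lambda>\<omega>. \<omega> i) = distr P borel (\<lambda>\<omega>. \<omega> 0)"
    using P by (auto simp: iid_laws_def)
  have [measurable]: "(\<lambda>\<omega>. \<omega> i) \<in> borel_measurable P" for i
    using indep by (auto simp: indep_vars_def)
  have int: "integrable P (\<lambda>\<omega>. \<omega> 0)"
    using integrable_norm_powr_mono[of "\<lambda>\<omega>. \<omega> 0" r 1] mom r by (simp add: integrable_norm_iff)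
  have coord: "AE \<omega> in P. \<forall>\<^sub>F N in sequentially.
      \<bar>truncated_mean (2 ^ floor_log N) (\<lambda>i. \<omega> i \<bullet> b) - mean P \<bullet> b\<bar>
        \<le> 2 * (2 powr ((1 - r) / 4)) ^ floor_log N" if b: "b \<in> Basis" for b
  proof -
    have 1: "indep_vars (\<lambda>_. borel) (\<lambda>i \<omega>. \<omega> i \<bullet> b) UNIV"
      by (rule indep_vars_compose2[OF indep]) simp
    have 2: "distr P borel (\<lambda>\<omega>. \<omega> i \<bullet> b) = distr P borel (\<lambda>\<omega>. \<omega> 0 \<bullet> b)" for i
    proof -
      have "distr P borel (\<lambda>\<omega>. \<omega> j \<bullet> b) = distr (distr P borel (\<lambda>\<omega>. \<omega> j)) borel (\<lambda>x. x \<bullet> b)" for j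
        by (subst distr_distr) (simp_all add: comp_def)
      then show ?thesis using ident[of i] by simp
    qed
    have 3: "integrable P (\<lambda>\<omega>. \<bar>\<omega> 0 \<bullet> b\<bar> powr r)"
      using mom by (rule Bochner_Integration.integrable_bound)
        (use Basis_le_norm[OF b] r in \<open>auto intro!: AE_I2 powr_mono2\<close>)
    have "expectation (\<lambda>\<omega>. \<omega> 0 \<bullet> b) = mean P \<bullet> b"
      using int by (simp add: mean_def)
    with truncated_mean_rate[OF 1 2 r 3]
    have "AE \<omega> in P. \<forall>\<^sub>F n in sequentially.
        \<bar>truncated_mean (2 ^ n) (\<lambda>i. \<omega> i \<bullet> b) - mean P \<bullet> b\<bar> \<le> 2 * (2 powr ((1 - r) / 4)) ^ n"
      by simp
    then show ?thesis
      by eventually_elim (rule eventually_compose_filterlim[OF _ filterlim_floor_log])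
  qed
  then have "AE \<omega> in P. \<forall>b\<in>Basis. \<forall>\<^sub>F N in sequentially.
      \<bar>truncated_mean (2 ^ floor_log N) (\<lambda>i. \<omega> i \<bullet> b) - mean P \<bullet> b\<bar>
        \<le> 2 * (2 powr ((1 - r) / 4)) ^ floor_log N"
    by (intro AE_finite_allI) auto
  then show ?thesis
  proof eventually_elim
    case (elim \<omega>)
    then have "\<forall>\<^sub>F N in sequentially. \<forall>b\<in>Basis.
      \<bar>truncated_mean (2 ^ floor_log N) (\<lambda>i. \<omega> i \<bullet> b) - mean P \<bullet> b\<bar>
        \<le> 2 * (2 powr ((1 - r) / 4)) ^ floor_log N"
      by (simp add: eventually_ball_finite_distrib)
    then show ?case
      using eventually_gt_at_top[of 0]
    proof eventually_elim
      case (elim N)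
      have "norm (dyadic_estimator N \<omega> - mean P)
          \<le> (\<Sum>b\<in>Basis. \<bar>(dyadic_estimator N \<omega> - mean P) \<bullet> b\<bar>)"
        by (rule norm_le_l1)
      also have "\<dots> \<le> (\<Sum>b\<in>(Basis::'a set). 2 * (2 powr ((1 - r) / 4)) ^ floor_log N)"
        using elim by (intro sum_mono) (simp add: dyadic_estimator_def inner_diff_left)
      finally show ?case
        using elim by (simp add: dyadic_estimator_restrict)
    qed
  qed
qed

section \<open>Predictability of semialgebraic sets\<close>

text \<open>
  The exponent is lowered to at most 2, since the variance bound for the truncated mean
  holds in that range only; a finite moment implies finiteness of all lower ones.
\<close>

theorem eventually_as_predictable_finite_moment:
  fixes S :: "'a::euclidean_space set"
  assumes S: "semialgebraic S" and r: "1 < r"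
  shows "eventually_as_predictable S {P \<in> iid_laws. integrable P (\<lambda>\<omega>. norm (\<omega> 0) powr r)}"
proof -
  define s where "s = min r 2"
  define q :: real where "q = 2 powr ((1 - s) / 4)"
  have s: "1 < s" "s \<le> 2" "s \<le> r" using r by (auto simp: s_def)
  have q: "0 < q" "q < 1"
    using s powr_less_mono[of "(1 - s) / 4" 0 2] by (auto simp: q_def)
  show ?thesis
  proof (rule eventually_as_predictable_semialgebraic[OF S _ dyadic_estimator_measurable])
    have "(\<lambda>n. real DIM('a) * (2 * q ^ n)) \<longlonglongrightarrow> real DIM('a) * (2 * 0)"
      using q by (intro tendsto_intros LIMSEQ_realpow_zero) auto
    then show "(\<lambda>N. real DIM('a) * (2 * q ^ floor_log N)) \<longlonglongrightarrow> 0"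
      using filterlim_compose[OF _ filterlim_floor_log] by fastforce
    show "0 < real DIM('a) * (2 * q ^ floor_log N)" for N
      using q by simp
    fix P :: "(nat \<Rightarrow> 'a) measure"
    assume "P \<in> {P \<in> iid_laws. integrable P (\<lambda>\<omega>. norm (\<omega> 0) powr r)}"
    then have P: "P \<in> iid_laws" and mom: "integrable P (\<lambda>\<omega>. norm (\<omega> 0) powr r)" by auto
    interpret prob_space P
      using P by (simp add: iid_laws_def)
    have "(\<lambda>\<omega>. \<omega> 0) \<in> borel_measurable P"
      using P by (auto simp: iid_laws_def indep_vars_def)
    from integrable_norm_powr_mono[OF this mom] have "integrable P (\<lambda>\<omega>. norm (\<omega> 0) powr s)"
      using s by simp
    from dyadic_estimator_rate[OF P s(1,2) this]
    show "AE \<omega> in P. \<forall>\<^sub>F N in sequentially.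
      norm (dyadic_estimator N (restrict \<omega> {..<N}) - mean P) \<le> real DIM('a) * (2 * q ^ floor_log N)"
      by (simp add: q_def)
  qed auto
qed

theorem theorem2p1:
  fixes S :: "(real ^ 'm) set"
  assumes "semialgebraic S"
  shows "eventually_as_predictable S
           {P \<in> iid_laws. \<forall>i. AE \<omega> in P. \<forall>j. 0 \<le> \<omega> i $ j \<and> \<omega> i $ j \<le> 1} \<and>
         (\<forall>r::real. r > 1 \<longrightarrow>
           eventually_as_predictable S
             {P \<in> iid_laws. integrable P (\<lambda>\<omega>. norm (\<omega> 0) powr r)})"
proof (intro conjI allI impI)
  show moment: "eventually_as_predictable S {P \<in> iid_laws. integrable P (\<lambda>\<omega>. norm (\<omega> 0) powr r)}"
    if "r > 1" for r :: real
    using eventually_as_predictable_finite_moment[OF assms that] .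
  show "eventually_as_predictable S
           {P \<in> iid_laws. \<forall>i. AE \<omega> in P. \<forall>j. 0 \<le> \<omega> i $ j \<and> \<omega> i $ j \<le> 1}"
  proof (rule eventually_as_predictable_mono[OF moment[of 2]], simp, safe)
    fix P :: "(nat \<Rightarrow> real ^ 'm) measure"
    assume P: "P \<in> iid_laws" and cube: "\<forall>i. AE \<omega> in P. \<forall>j. 0 \<le> \<omega> i $ j \<and> \<omega> i $ j \<le> 1"
    interpret prob_space P
      using P by (simp add: iid_laws_def)
    have [measurable]: "(\<lambda>\<omega>. \<omega> 0) \<in> borel_measurable P"
      using P by (auto simp: iid_laws_def indep_vars_def)
    have bound: "norm x powr 2 \<le> real CARD('m) powr 2"
      if "\<forall>j. 0 \<le> x $ j \<and> x $ j \<le> 1" for x :: "real ^ 'm"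
    proof -
      have "norm x \<le> (\<Sum>j\<in>UNIV. \<bar>x $ j\<bar>)"
        by (rule norm_le_l1_cart)
      also have "\<dots> \<le> (\<Sum>j\<in>(UNIV::'m set). 1)"
        using that by (intro sum_mono) auto
      finally show ?thesis by (intro powr_mono2) auto
    qed
    have "AE \<omega> in P. norm (norm (\<omega> 0) powr 2) \<le> real CARD('m) powr 2"
      using spec[OF cube, of 0] by eventually_elim (use bound in auto)
    then show "integrable P (\<lambda>\<omega>. norm (\<omega> 0) powr 2)"
      by (rule integrable_const_bound) measurable
  qed
qed

end
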